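(* Let $A$ be a unital complex Banach algebra and let $a\in\mathcal{V}(A)$ be such that its Moore-Penrose inverse $a^{\dag}$ exists. Then, for each one of the conditions (i)--(x) below, $a$ is normal if and only if the group inverse $a^{\sharp}$ exists and that condition holds: (i) $aa^*a^{\sharp}=a^*a^{\sharp}a$ and $a=a^{\dag}aa$; (ii) $aa^*a^{\sharp}=a^{\sharp}aa^*$ and $a=aaa^{\dag}$; (iii) $aa^{\sharp}a^*=a^{\sharp}a^*a$ and $a=aaa^{\dag}$; (iv) $a^*aa^{\sharp}=a^{\sharp}a^*a$ and $a=a^{\dag}aa$; (v) $a^{\dag}a^*a^{\sharp}=a^{\dag}a^{\sharp}a^*$ and $a=aaa^{\dag}$; (vi) $a^*a^{\sharp}a^{\dag}=a^{\sharp}a^*a^{\dag}$ and $a=a^{\dag}aa$; (vii) $a^*=aa^*a^{\sharp}$; (viii) $a^*=a^{\sharp}a^*a$; (ix) $aa^*a=a^*aa$ and $a=a^{\dag}aa$; (x) $aaa^*=aa^*a$ and $a=aaa^{\dag}$.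
   Context: Let $A$ be a unital complex Banach algebra. An element $h\in A$ is hermitian if $\|\exp(ith)\|=1$ for all $t\in\mathbb{R}$; $\mathcal{H}(A)$ denotes the set of hermitian elements of $A$, and $\mathcal{V}(A)=\mathcal{H}(A)+i\mathcal{H}(A)$. Each $a\in\mathcal{V}(A)$ has a unique representation $a=u+iv$ with $u,v\in\mathcal{H}(A)$, and one sets $a^*=u-iv$ (this operation on $\mathcal{V}(A)$ is not in general an algebra involution; in particular $(ab)^*=b^*a^*$ may fail). The element $a=u+iv\in\mathcal{V}(A)$ is normal if $uv=vu$ (equivalently, $aa^*=a^*a$). Given $a\in A$, an element $x\in A$ is the Moore-Penrose inverse of $a$, denoted $a^{\dag}$, if $a=axa$, $x=xax$, and both $ax$ and $xa$ are hermitian; there is at most one such $x$. An element $b\in A$ is the group inverse of $a$, denoted $a^{\sharp}$, if $a=aba$, $b=bab$ and $ab=ba$; it is unique if it exists. *)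

theory Defs
  imports "HOL-Analysis.Analysis"
begin

text \<open>The library only has real Banach algebras. We add a compatible complex scalar multiplication.
  The class \<open>real_normed_algebra_1\<close> includes \<open>norm 1 = 1\<close>; this loses no generality below, since
  putting \<open>t = 0\<close> in the definition of a hermitian element forces it as soon as one exists.\<close>

class complex_banach_algebra_1 = real_normed_algebra_1 + banach +
  fixes scaleC :: "complex \<Rightarrow> 'a \<Rightarrow> 'a"  (infixr \<open>*\<^sub>C\<close> 75)
  assumes scaleC_add_right: "c *\<^sub>C (x + y) = c *\<^sub>C x + c *\<^sub>C y"
    and scaleC_add_left: "(c + d) *\<^sub>C x = c *\<^sub>C x + d *\<^sub>C x"
    and scaleC_scaleC: "c *\<^sub>C d *\<^sub>C x = (c * d) *\<^sub>C x"
    and scaleC_of_real: "complex_of_real r *\<^sub>C x = r *\<^sub>R x"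
    and mult_scaleC_left: "(c *\<^sub>C x) * y = c *\<^sub>C (x * y)"
    and mult_scaleC_right: "x * (c *\<^sub>C y) = c *\<^sub>C (x * y)"
    and norm_scaleC: "norm (c *\<^sub>C x) = cmod c * norm x"

definition hermitian :: "'a::complex_banach_algebra_1 \<Rightarrow> bool" where
  "hermitian h \<longleftrightarrow> (\<forall>t::real. norm (exp ((\<i> * complex_of_real t) *\<^sub>C h)) = 1)"

definition V_set :: "'a::complex_banach_algebra_1 set" where
  "V_set = {u + \<i> *\<^sub>C v | u v. hermitian u \<and> hermitian v}"

text \<open>Well defined on \<open>V_set\<close> only, where the representation \<open>a = u + \<i> *\<^sub>C v\<close> is unique.\<close>

definition star :: "'a::complex_banach_algebra_1 \<Rightarrow> 'a"  (\<open>(_\<^sup>\<star>)\<close> [1000] 999) where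
  "a\<^sup>\<star> = (THE b. \<exists>u v. hermitian u \<and> hermitian v \<and> a = u + \<i> *\<^sub>C v \<and> b = u - \<i> *\<^sub>C v)"

definition normal :: "'a::complex_banach_algebra_1 \<Rightarrow> bool" where
  "normal a \<longleftrightarrow> (\<exists>u v. hermitian u \<and> hermitian v \<and> a = u + \<i> *\<^sub>C v \<and> u * v = v * u)"

definition is_mp_inverse :: "'a::complex_banach_algebra_1 \<Rightarrow> 'a \<Rightarrow> bool" where
  "is_mp_inverse a x \<longleftrightarrow>
     a = a * x * a \<and> x = x * a * x \<and> hermitian (a * x) \<and> hermitian (x * a)"

definition mp_inverse :: "'a::complex_banach_algebra_1 \<Rightarrow> 'a"  (\<open>(_\<^sup>\<dagger>)\<close> [1000] 999) where
  "a\<^sup>\<dagger> = (THE x. is_mp_inverse a x)"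

definition is_group_inverse :: "'a::complex_banach_algebra_1 \<Rightarrow> 'a \<Rightarrow> bool" where
  "is_group_inverse a b \<longleftrightarrow> a = a * b * a \<and> b = b * a * b \<and> a * b = b * a"

definition group_inverse :: "'a::complex_banach_algebra_1 \<Rightarrow> 'a"  (\<open>(_\<^sup>\<sharp>)\<close> [1000] 999) where
  "a\<^sup>\<sharp> = (THE b. is_group_inverse a b)"

text \<open>\<open>a\<^sup>\<dagger>\<close> and \<open>a\<^sup>\<sharp>\<close> are meaningful only when the inverse exists (it is then unique), which is
  expressed by the following predicates.\<close>

definition mp_invertible :: "'a::complex_banach_algebra_1 \<Rightarrow> bool" where
  "mp_invertible a \<longleftrightarrow> (\<exists>x. is_mp_inverse a x)"

definition group_invertible :: "'a::complex_banach_algebra_1 \<Rightarrow> bool" where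
  "group_invertible a \<longleftrightarrow> (\<exists>b. is_group_inverse a b)"

end

theory Submission imports Defs begin

text \<open>
  Let \<open>x\<close> be the Moore-Penrose inverse of \<open>a\<close>, with hermitian idempotents \<open>p = a x\<close> and \<open>q = x a\<close>.
  The ten conditions are one and the same statement once \<open>p = q\<close>. In that case \<open>x\<close> is also the group
  inverse, \<open>p\<close> is a unit for \<open>a\<close>, and it turns out to be a unit for \<open>a\<^sup>\<star>\<close> too
  (\<open>star_in_corner\<close>). So \<open>a\<close> and \<open>x\<close> are mutually inverse in the corner \<open>pAp\<close>, which contains
  \<open>a\<^sup>\<star>\<close>, and each of the equations can be multiplied through by \<open>a\<close> or \<open>x\<close> until it says that \<open>a\<close>
  commutes with \<open>a\<^sup>\<star>\<close> (\<open>corner_commute_iff\<close>, \<open>corner_commute_cancel\<close>). It remains to see that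
  \<open>p = q\<close> follows from each side of each equivalence.

  From a group inverse \<open>b\<close> together with \<open>a = x a a\<close> (or \<open>a = a a x\<close>), the idempotent \<open>a b\<close> equals one of
  \<open>p\<close>, \<open>q\<close>, hence is hermitian, and shares its range or its kernel with the other. Hermitian idempotents
  with the same range or kernel coincide, since their difference is hermitian of square zero.
  The conditions \<open>a\<^sup>\<star> = a a\<^sup>\<star> b\<close> and \<open>a\<^sup>\<star> = b a\<^sup>\<star> a\<close> only give \<open>p a\<^sup>\<star> = a\<^sup>\<star>\<close>,
  respectively \<open>a\<^sup>\<star> q = a\<^sup>\<star>\<close>; there one uses that for a hermitian \<open>h\<close> the equations \<open>p h = h\<close> and \<open>h p = h\<close> are equivalent
  (\<open>hermitian_idempotent_left_iff_right\<close>), applied to the real and imaginary parts of \<open>a\<close>.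
  If \<open>a\<close> is normal, the argument of Fuglede and Rosenblum shows that \<open>a\<close> and \<open>a\<^sup>\<star>\<close> have the
  same annihilators (\<open>normal_annihilator\<close>), so that \<open>p\<close> and \<open>q\<close> are units for \<open>a\<^sup>\<star>\<close> on the sides where
  they are for \<open>a\<close>, and the same equivalence gives \<open>p = q\<close>.

  As \<open>(a b)\<^sup>\<star>\<close> need not be \<open>b\<^sup>\<star> a\<^sup>\<star>\<close>, the usual manipulations with adjoints are replaced by the
  reflection \<open>1 - 2 p = exp (\<i> \<pi> p)\<close>, an isometric involution, conjugation by which preserves hermitian
  elements; and a Liouville theorem for the entire functions \<open>z \<mapsto> y exp (z c) y'\<close>
  (\<open>bounded_exp_orbit_imp_zero\<close>). The latter also yields that the representation
  \<open>u + \<i> v\<close> is unique, once the hermitian elements are known to form a real vector space.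
\<close>

section \<open>Complex scalars and intertwining\<close>

lemma scaleC_one [simp]: "1 *\<^sub>C x = x"
  for x :: "'a::complex_banach_algebra_1"
  using scaleC_of_real[of 1 x] by simp

lemma scaleC_zero_left [simp]: "0 *\<^sub>C x = 0"
  for x :: "'a::complex_banach_algebra_1"
  using scaleC_of_real[of 0 x] by simp

lemma scaleC_minus_left: "(- c) *\<^sub>C x = - (c *\<^sub>C x)"
  for x :: "'a::complex_banach_algebra_1"
  using scaleC_add_left[of c "-c" x] by (simp add: eq_neg_iff_add_eq_0 add.commute)

lemma scaleC_zero_right [simp]: "c *\<^sub>C (0::'a::complex_banach_algebra_1) = 0"
  using scaleC_add_right[of c 0 "0::'a"] by simp

lemma scaleC_minus_right: "c *\<^sub>C (- x) = - (c *\<^sub>C x)"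
  for x :: "'a::complex_banach_algebra_1"
  using scaleC_add_right[of c x "-x"] by (simp add: eq_neg_iff_add_eq_0 add.commute)

lemma scaleC_diff_right: "c *\<^sub>C (x - y) = c *\<^sub>C x - c *\<^sub>C y"
  for x :: "'a::complex_banach_algebra_1"
  using scaleC_add_right[of c x "-y"] by (simp add: scaleC_minus_right)

lemma scaleC_scaleR: "c *\<^sub>C (r *\<^sub>R x) = r *\<^sub>R (c *\<^sub>C x)"
  for x :: "'a::complex_banach_algebra_1"
  by (metis mult.commute scaleC_of_real scaleC_scaleC)

lemma scaleR_scaleC: "(r *\<^sub>R c) *\<^sub>C x = r *\<^sub>R (c *\<^sub>C x)"
  for x :: "'a::complex_banach_algebra_1"
  by (metis scaleC_of_real scaleC_scaleC scaleR_conv_of_real)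

lemma bounded_linear_scaleC_right: "bounded_linear (\<lambda>x::'a::complex_banach_algebra_1. c *\<^sub>C x)"
  by (rule bounded_linear_intro[where K = "cmod c"])
    (simp_all add: scaleC_add_right scaleC_scaleR norm_scaleC mult.commute)

lemma bounded_linear_scaleC_left: "bounded_linear (\<lambda>c. c *\<^sub>C (x::'a::complex_banach_algebra_1))"
  by (rule bounded_linear_intro[where K = "norm x"])
    (simp_all add: scaleC_add_left scaleR_scaleC norm_scaleC)

lemma scaleC_sum_left: "(\<Sum>k\<in>S. f k) *\<^sub>C x = (\<Sum>k\<in>S. f k *\<^sub>C x)"
  for x :: "'a::complex_banach_algebra_1"
  using bounded_linear.linear[OF bounded_linear_scaleC_left] by (rule linear_sum)

lemma scaleC_power: "(c *\<^sub>C x) ^ n = (c ^ n) *\<^sub>C (x ^ n)"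
  for x :: "'a::complex_banach_algebra_1"
  by (induction n) (simp_all add: mult_scaleC_left mult_scaleC_right scaleC_scaleC mult.commute)

lemma exp_scaleC_one: "exp (z *\<^sub>C (1::'a::complex_banach_algebra_1)) = exp z *\<^sub>C 1"
proof -
  have "(\<lambda>n. (z ^ n /\<^sub>R fact n) *\<^sub>C (1::'a)) sums (exp z *\<^sub>C 1)"
    by (rule bounded_linear.sums[OF bounded_linear_scaleC_left exp_converges])
  moreover have "(\<lambda>n. (z *\<^sub>C (1::'a)) ^ n /\<^sub>R fact n) sums exp (z *\<^sub>C 1)"
    by (rule exp_converges)
  ultimately show ?thesis
    by (simp add: scaleC_power scaleR_scaleC sums_unique2)
qed

text \<open>Many exponentials below are evaluated with this identity: \<open>X\<close> is chosen so that \<open>A\<close> acts on it like a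
  simpler element \<open>B\<close>, such as \<open>0\<close> or a scalar.\<close>

lemma exp_intertwine:
  fixes A B X :: "'a::{real_normed_algebra_1,banach}"
  assumes "A * X = X * B"
  shows "exp A * X = X * exp B"
proof -
  have pow: "A ^ n * X = X * B ^ n" for n
  proof (induction n)
    case (Suc n)
    have "A ^ Suc n * X = A * (A ^ n * X)" by (simp add: mult.assoc)
    also have "\<dots> = (A * X) * B ^ n" using Suc by (simp add: mult.assoc)
    also have "\<dots> = X * B ^ Suc n" using assms by (simp add: mult.assoc)
    finally show ?case .
  qed simp
  have "(\<lambda>n. A ^ n /\<^sub>R fact n * X) sums (exp A * X)"
    by (rule sums_mult2[OF exp_converges])
  moreover have "(\<lambda>n. X * (B ^ n /\<^sub>R fact n)) sums (X * exp B)"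
    by (rule sums_mult[OF exp_converges])
  ultimately show ?thesis
    by (simp add: pow sums_unique2)
qed

lemma exp_mult_eq_self:
  fixes A X :: "'a::{real_normed_algebra_1,banach}"
  assumes "A * X = 0"
  shows "exp A * X = X"
  using exp_intertwine[of A X 0] assms by simp

lemma mult_exp_eq_self:
  fixes B X :: "'a::{real_normed_algebra_1,banach}"
  assumes "X * B = 0"
  shows "X * exp B = X"
  using exp_intertwine[of 0 X B] assms by simp

section \<open>A Liouville theorem for exponential orbits\<close>

lemma sum_roots_of_unity_powers:
  fixes n N :: nat
  defines "\<omega> \<equiv> exp (2 * of_real pi * \<i> / of_nat N)"
  assumes "n < N" "2 \<le> N"
  shows "(\<Sum>k<N. (\<omega> ^ n / \<omega>) ^ k) = (if n = 1 then of_nat N else 0)"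
proof -
  have pow: "\<omega> ^ j = exp (2 * of_real pi * \<i> * of_nat j / of_nat N)" for j
    unfolding \<omega>_def by (simp add: exp_of_nat_mult[symmetric] algebra_simps)
  have nz: "\<omega> \<noteq> 0" by (simp add: \<omega>_def)
  have "\<omega> ^ N = 1" using assms(3) unfolding pow by (simp add: complex_root_unity_eq_1)
  then have N: "(\<omega> ^ n / \<omega>) ^ N = 1"
    by (simp add: power_divide power_mult[symmetric] mult.commute[of n N]) (simp add: power_mult)
  have "\<omega> ^ n / \<omega> = 1 \<longleftrightarrow> \<omega> ^ n = \<omega> ^ 1" using nz by simp
  also have "\<dots> \<longleftrightarrow> n mod N = 1 mod N"
    unfolding pow using assms(3) by (intro complex_root_unity_eq) simp
  also have "\<dots> \<longleftrightarrow> n = 1" using assms(2,3) by simp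
  finally show ?thesis by (simp add: sum_gp_strict N)
qed

text \<open>Cauchy's estimate for the linear Taylor coefficient, with the contour integral over the circle of radius \<open>r\<close>
  replaced by the average over its \<open>N\<close> points \<open>r \<omega>\<^sup>k\<close>. Weighted by \<open>\<omega>\<^sup>-\<^sup>k\<close>, the average kills all coefficients
  below \<open>N\<close> except the linear one; the remaining tail of the exponential series vanishes as \<open>N\<close> grows.\<close>

lemma exp_orbit_linear_coefficient_bound:
  fixes c y y' :: "'a::complex_banach_algebra_1"
  assumes bound: "\<And>z. norm (y * exp (z *\<^sub>C c) * y') \<le> C" and r: "0 \<le> r"
  shows "r * norm (y * c * y') \<le> C"
proof -
  define d where "d n = y * c ^ n * y' /\<^sub>R fact n" for n
  define D where "D n = norm y * norm y' * ((r * norm c) ^ n /\<^sub>R fact n)" for n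
  have D: "summable D"
    unfolding D_def by (intro summable_mult summable_exp_generic)
  have dD: "r ^ n * norm (d n) \<le> D n" for n
  proof -
    have "norm (y * c ^ n * y') \<le> norm y * norm c ^ n * norm y'"
      by (meson norm_mult_ineq norm_power_ineq mult_left_mono mult_right_mono norm_ge_zero order_trans)
    then have "r ^ n * norm (y * c ^ n * y') / fact n \<le> r ^ n * (norm y * norm c ^ n * norm y') / fact n"
      using r by (intro divide_right_mono mult_left_mono) auto
    then show ?thesis
      by (simp add: d_def D_def power_mult_distrib field_simps)
  qed
  have orbit: "(\<lambda>n. z ^ n *\<^sub>C d n) sums (y * exp (z *\<^sub>C c) * y')" for z
    using sums_mult2[OF sums_mult[OF exp_converges[of "z *\<^sub>C c"], of y], of y']
    by (simp add: d_def scaleC_power mult_scaleC_left mult_scaleC_right scaleC_scaleR mult.assoc)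
  have step: "r * norm (d 1) \<le> C + (\<Sum>n. D (n + N))" if N: "2 \<le> N" for N
  proof -
    define \<omega> where "\<omega> = exp (2 * of_real pi * \<i> / of_nat N)"
    have \<omega>: "cmod \<omega> = 1" "\<omega> \<noteq> 0" by (simp_all add: \<omega>_def norm_exp_eq_Re)
    define m where "m n = (\<Sum>k<N. inverse (\<omega> ^ k) * (of_real r * \<omega> ^ k) ^ n)" for n
    define S where "S = (\<Sum>k<N. inverse (\<omega> ^ k) *\<^sub>C (y * exp ((of_real r * \<omega> ^ k) *\<^sub>C c) * y'))"
    have "(\<lambda>n. \<Sum>k<N. inverse (\<omega> ^ k) *\<^sub>C ((of_real r * \<omega> ^ k) ^ n *\<^sub>C d n)) sums S"
      unfolding S_def by (intro sums_sum bounded_linear.sums[OF bounded_linear_scaleC_right] orbit)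
    then have "(\<lambda>n. m n *\<^sub>C d n) sums S"
      by (simp add: m_def scaleC_sum_left scaleC_scaleC)
    from sums_split_initial_segment[OF this, of N]
    have tail: "(\<lambda>n. m (n + N) *\<^sub>C d (n + N)) sums (S - (\<Sum>n<N. m n *\<^sub>C d n))" .
    \<comment> \<open>\<open>m n / N\<close> is the weight with which the average picks up the coefficient \<open>d n\<close>.\<close>
    have m_low: "m n = (if n = 1 then of_nat N * of_real r else 0)" if "n < N" for n
    proof -
      have "m n = of_real r ^ n * (\<Sum>k<N. (\<omega> ^ n / \<omega>) ^ k)"
        unfolding m_def sum_distrib_left
        by (intro sum.cong refl) (simp add: power_mult_distrib power_divide divide_inverse
            power_mult[symmetric] mult_ac power_inverse)
      then show ?thesis
        using sum_roots_of_unity_powers[OF that N] by (simp add: \<omega>_def)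
    qed
    have "(\<Sum>n<N. m n *\<^sub>C d n) = (\<Sum>n<N. if n = 1 then (of_nat N * of_real r) *\<^sub>C d 1 else 0)"
      by (intro sum.cong refl) (simp add: m_low)
    also have "\<dots> = (of_nat N * of_real r) *\<^sub>C d 1"
      using N by simp
    finally have low: "(\<Sum>n<N. m n *\<^sub>C d n) = (of_nat N * of_real r) *\<^sub>C d 1" .
    have "cmod (m n) \<le> (\<Sum>k<N. r ^ n)" for n
      unfolding m_def by (intro sum_norm_le)
        (simp add: norm_mult norm_inverse norm_power \<omega> r power_mult_distrib)
    then have m_le: "cmod (m n) \<le> N * r ^ n" for n by simp
    have tail_le: "norm (m (n + N) *\<^sub>C d (n + N)) \<le> N * D (n + N)" for n
    proof -
      have "norm (m (n + N) *\<^sub>C d (n + N)) \<le> (N * r ^ (n + N)) * norm (d (n + N))"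
        unfolding norm_scaleC by (intro mult_right_mono m_le) simp
      also have "\<dots> \<le> N * D (n + N)"
        unfolding mult.assoc by (intro mult_left_mono dD) simp
      finally show ?thesis .
    qed
    have sD: "summable (\<lambda>n. D (n + N))" by (rule summable_ignore_initial_segment[OF D])
    have "norm (S - (of_nat N * of_real r) *\<^sub>C d 1) \<le> (\<Sum>n. N * D (n + N))"
      using norm_suminf_le[OF tail_le summable_mult[OF sD]] sums_unique[OF tail] low by simp
    then have 1: "norm (S - (of_nat N * of_real r) *\<^sub>C d 1) \<le> N * (\<Sum>n. D (n + N))"
      by (simp add: suminf_mult[OF sD])
    have "norm S \<le> (\<Sum>k<N. C)"
      unfolding S_def by (intro sum_norm_le)
        (use bound in \<open>simp add: norm_scaleC norm_inverse norm_power \<omega>\<close>)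
    then have 2: "norm S \<le> N * C" by simp
    have "N * (r * norm (d 1)) = norm ((of_nat N * of_real r) *\<^sub>C d 1)"
      using r by (simp add: norm_scaleC norm_mult)
    also have "\<dots> \<le> norm S + norm (S - (of_nat N * of_real r) *\<^sub>C d 1)"
      by (metis norm_minus_commute norm_triangle_sub)
    also have "\<dots> \<le> N * (C + (\<Sum>n. D (n + N)))"
      using 1 2 by (simp add: algebra_simps)
    finally show ?thesis using N by simp
  qed
  have "r * norm (d 1) \<le> C"
  proof (rule field_le_epsilon)
    fix e :: real assume "0 < e"
    from suminf_exist_split[OF this D] obtain N where N: "\<And>n. n \<ge> N \<Longrightarrow> norm (\<Sum>i. D (i + n)) < e"
      by auto
    show "r * norm (d 1) \<le> C + e"
      using step[of "max 2 N"] N[of "max 2 N"] by (auto simp: abs_less_iff)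
  qed
  then show ?thesis by (simp add: d_def)
qed

text \<open>Liouville: let the radius tend to infinity in Cauchy's estimate.\<close>

lemma bounded_exp_orbit_imp_zero:
  fixes c y y' :: "'a::complex_banach_algebra_1"
  assumes "\<And>z. norm (y * exp (z *\<^sub>C c) * y') \<le> C"
  shows "y * c * y' = 0"
proof (rule ccontr)
  assume "y * c * y' \<noteq> 0"
  then have pos: "norm (y * c * y') > 0" by simp
  have "0 \<le> C" using assms[of 0] norm_ge_zero order_trans by blast
  then have "(C + 1) / norm (y * c * y') * norm (y * c * y') \<le> C"
    by (intro exp_orbit_linear_coefficient_bound assms) (use pos in auto)
  then show False using pos by simp
qed

section \<open>Hermitian elements\<close>

lemma hermitianD: "hermitian h \<Longrightarrow> norm (exp ((\<i> * complex_of_real t) *\<^sub>C h)) = 1"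
  by (simp add: hermitian_def)

text \<open>The lower bound is automatic because \<open>exp (\<i>t h)\<close> has inverse \<open>exp (- \<i>t h)\<close>.\<close>

lemma hermitianI:
  assumes "\<And>t::real. norm (exp ((\<i> * complex_of_real t) *\<^sub>C h)) \<le> 1"
  shows "hermitian h"
  unfolding hermitian_def
proof (intro allI antisym assms)
  fix t :: real
  let ?E = "\<lambda>t. exp ((\<i> * complex_of_real t) *\<^sub>C h)"
  have "?E t * ?E (- t) = 1"
    using exp_minus_inverse[of "(\<i> * complex_of_real t) *\<^sub>C h"] by (simp add: scaleC_minus_left)
  then have "1 \<le> norm (?E t) * norm (?E (- t))"
    by (metis norm_mult_ineq norm_one)
  also have "\<dots> \<le> norm (?E t) * 1"
    by (intro mult_left_mono assms) simp
  finally show "1 \<le> norm (?E t)" by simp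
qed

lemma hermitian_scaleR: "hermitian h \<Longrightarrow> hermitian (r *\<^sub>R h)"
  using hermitianD[of h "t * r" for t]
  by (intro hermitianI) (simp add: scaleC_of_real[symmetric] scaleC_scaleC mult.assoc)

lemma hermitian_minus: "hermitian h \<Longrightarrow> hermitian (- h)"
  using hermitian_scaleR[of h "-1"] by simp

lemma exp_scaleR_power: "exp (x /\<^sub>R real (Suc n)) ^ Suc n = exp x"
  for x :: "'a::{real_normed_algebra_1,banach}"
proof -
  have "exp (real m *\<^sub>R y) = exp y ^ m" for y :: 'a and m
    by (induction m) (auto simp: scaleR_add_left exp_add_commuting)
  from this[of "Suc n" "x /\<^sub>R real (Suc n)"] show ?thesis by simp
qed

text \<open>Lie's product formula in disguise: \<open>exp (s (X + Y))\<close> and \<open>exp (s X) exp (s Y)\<close> agree to first order at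
  \<open>s = 0\<close>, so \<open>exp ((X + Y) / n)\<close> has norm at most \<open>1 + e / n\<close> for large \<open>n\<close>, and its \<open>n\<close>-th power has norm
  at most \<open>exp e\<close>.\<close>

lemma norm_exp_add_le_one:
  fixes X Y :: "'a::{real_normed_algebra_1,banach}"
  assumes X: "\<And>s::real. norm (exp (s *\<^sub>R X)) \<le> 1" and Y: "\<And>s::real. norm (exp (s *\<^sub>R Y)) \<le> 1"
  shows "norm (exp (X + Y)) \<le> 1"
proof -
  define f where "f s = exp (s *\<^sub>R (X + Y)) - exp (s *\<^sub>R X) * exp (s *\<^sub>R Y)" for s :: real
  have "(f has_vector_derivative
      exp (0 *\<^sub>R (X + Y)) * (X + Y) - (exp (0 *\<^sub>R X) * (exp (0 *\<^sub>R Y) * Y) + exp (0 *\<^sub>R X) * X * exp (0 *\<^sub>R Y))) (at 0)"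
    unfolding f_def
    by (intro has_vector_derivative_diff has_vector_derivative_mult exp_scaleR_has_vector_derivative_right)
  then have "(f has_vector_derivative 0) (at 0)" by simp
  then have lim: "((\<lambda>s. norm (f s) / norm s) \<longlongrightarrow> 0) (at 0)"
    by (simp add: has_vector_derivative_def has_derivative_at f_def)
  have "norm (exp (X + Y)) \<le> exp e" if e: "0 < e" for e :: real
  proof -
    from lim e have "eventually (\<lambda>s. norm (f s) / norm s < e) (at 0)"
      using order_tendstoD(2) by blast
    then obtain \<delta> where \<delta>: "\<delta> > 0" "\<And>s. s \<noteq> 0 \<Longrightarrow> norm s < \<delta> \<Longrightarrow> norm (f s) / norm s < e"
      by (auto simp: eventually_at dist_norm)
    obtain n where n: "inverse (real (Suc n)) < \<delta>" using reals_Archimedean[OF \<delta>(1)] by auto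
    define s where "s = inverse (real (Suc n))"
    have s: "s > 0" by (simp add: s_def)
    have "norm (f s) \<le> e * s" using \<delta>(2)[of s] n s by (simp add: s_def field_simps)
    moreover have "norm (exp (s *\<^sub>R X) * exp (s *\<^sub>R Y)) \<le> 1"
      using norm_mult_ineq[of "exp (s *\<^sub>R X)" "exp (s *\<^sub>R Y)"] mult_mono[OF X[of s] Y[of s]] by simp
    moreover have "norm (exp (s *\<^sub>R (X + Y))) \<le> norm (f s) + norm (exp (s *\<^sub>R X) * exp (s *\<^sub>R Y))"
      using norm_triangle_ineq[of "f s" "exp (s *\<^sub>R X) * exp (s *\<^sub>R Y)"] by (simp add: f_def)
    ultimately have "norm (exp (s *\<^sub>R (X + Y))) \<le> 1 + e * s" by linarith
    also have "\<dots> \<le> exp (e * s)" by (rule exp_ge_add_one_self)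
    finally have le: "norm (exp (s *\<^sub>R (X + Y))) \<le> exp (e * s)" .
    have "norm (exp (X + Y)) = norm (exp (s *\<^sub>R (X + Y)) ^ Suc n)"
      by (simp only: s_def exp_scaleR_power)
    also have "\<dots> \<le> exp (e * s) ^ Suc n"
      by (rule order_trans[OF norm_power_ineq power_mono[OF le norm_ge_zero]])
    also have "\<dots> = exp e"
    proof -
      have "real (Suc n) * (e * s) = e" by (simp add: s_def del: of_nat_Suc)
      then show ?thesis by (simp only: exp_of_nat_mult[symmetric])
    qed
    finally show ?thesis .
  qed
  then have "\<forall>\<^sub>F e in at_right (0::real). norm (exp (X + Y)) \<le> exp e"
    by (auto simp: eventually_at_right_less eventually_at_filter)
  moreover have "((\<lambda>e::real. exp e) \<longlongrightarrow> exp 0) (at_right 0)"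
    by (intro tendsto_intros)
  ultimately show ?thesis
    using tendsto_lowerbound[of exp "exp (0::real)" "at_right 0" "norm (exp (X + Y))"] by simp
qed

lemma hermitian_add:
  assumes "hermitian h" "hermitian k"
  shows "hermitian (h + k)"
proof (rule hermitianI)
  fix t :: real
  have "norm (exp (s *\<^sub>R ((\<i> * complex_of_real t) *\<^sub>C x))) \<le> 1" if "hermitian x" for s and x :: 'a
    using hermitianD[OF that, of "s * t"]
    by (simp add: scaleC_of_real[symmetric] scaleC_scaleC mult_ac)
  with assms show "norm (exp ((\<i> * complex_of_real t) *\<^sub>C (h + k))) \<le> 1"
    unfolding scaleC_add_right by (intro norm_exp_add_le_one) auto
qed

lemma hermitian_diff: "hermitian h \<Longrightarrow> hermitian k \<Longrightarrow> hermitian (h - k)"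
  using hermitian_add[of h "-k"] hermitian_minus[of k] by simp

lemma norm_exp_hermitian_mult:
  assumes "hermitian h"
  shows "norm (exp ((\<i> * complex_of_real t) *\<^sub>C h) * x) \<le> norm x"
  using norm_mult_ineq[of "exp ((\<i> * complex_of_real t) *\<^sub>C h)" x] by (simp add: hermitianD[OF assms])

lemma norm_mult_exp_hermitian:
  assumes "hermitian h"
  shows "norm (x * exp ((\<i> * complex_of_real t) *\<^sub>C h)) \<le> norm x"
  using norm_mult_ineq[of x "exp ((\<i> * complex_of_real t) *\<^sub>C h)"] by (simp add: hermitianD[OF assms])

text \<open>On \<open>e\<close>, the element \<open>u\<close> acts as \<open>- \<i> v\<close>, so \<open>exp (s u) e = e exp (- \<i>s v)\<close> is bounded for real \<open>s\<close>; it is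
  bounded in imaginary directions because \<open>u\<close> is hermitian. Liouville applies. With \<open>e = 1\<close> this says that only
  \<open>0\<close> is both hermitian and \<open>\<i>\<close> times a hermitian element.\<close>

lemma hermitian_annihilator:
  assumes u: "hermitian u" and v: "hermitian v"
    and uv: "(u + \<i> *\<^sub>C v) * e = 0" and comm: "e * v = v * e"
  shows "u * e = 0"
proof -
  have "norm (1 * exp (z *\<^sub>C u) * e) \<le> norm e" for z
  proof -
    let ?s = "complex_of_real (Re z)"
    have z: "z = \<i> * complex_of_real (Im z) + ?s" by (simp add: complex_eq add.commute)
    have "u * e = - (\<i> *\<^sub>C (v * e))"
      using uv by (simp add: distrib_right mult_scaleC_left eq_neg_iff_add_eq_0)
    then have "(?s *\<^sub>C u) * e = e * ((\<i> * complex_of_real (- Re z)) *\<^sub>C v)"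
      by (simp add: mult_scaleC_left mult_scaleC_right scaleC_minus_left scaleC_minus_right
          scaleC_scaleC comm mult.commute)
    then have s: "exp (?s *\<^sub>C u) * e = e * exp ((\<i> * complex_of_real (- Re z)) *\<^sub>C v)"
      by (rule exp_intertwine)
    have "exp (z *\<^sub>C u) = exp ((\<i> * complex_of_real (Im z)) *\<^sub>C u) * exp (?s *\<^sub>C u)"
      by (subst z, unfold scaleC_add_left, rule exp_add_commuting)
        (simp add: mult_scaleC_left mult_scaleC_right scaleC_scaleC mult.commute)
    then have "norm (1 * exp (z *\<^sub>C u) * e) \<le> norm (exp (?s *\<^sub>C u) * e)"
      using norm_exp_hermitian_mult[OF u] by (simp add: mult.assoc)
    also have "\<dots> \<le> norm e" unfolding s by (rule norm_mult_exp_hermitian[OF v])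
    finally show ?thesis .
  qed
  from bounded_exp_orbit_imp_zero[OF this] show ?thesis by simp
qed

lemma hermitian_decomposition_unique:
  assumes "hermitian u" "hermitian v" "hermitian u'" "hermitian v'"
    and eq: "u + \<i> *\<^sub>C v = u' + \<i> *\<^sub>C v'"
  shows "u = u'" and "v = v'"
proof -
  have "((u - u') + \<i> *\<^sub>C (v - v')) * 1 = 0"
    using eq by (simp add: scaleC_diff_right algebra_simps)
  then have "(u - u') * 1 = 0"
    by (rule hermitian_annihilator[rotated 2]) (simp_all add: hermitian_diff assms)
  then show u: "u = u'" by simp
  with eq have "\<i> *\<^sub>C v = \<i> *\<^sub>C v'" by simp
  then have "(- \<i>) *\<^sub>C \<i> *\<^sub>C v = (- \<i>) *\<^sub>C \<i> *\<^sub>C v'" by simp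
  then show "v = v'" by (simp add: scaleC_scaleC)
qed

lemma star_eq:
  assumes "hermitian u" "hermitian v"
  shows "(u + \<i> *\<^sub>C v)\<^sup>\<star> = u - \<i> *\<^sub>C v"
  unfolding star_def
proof (rule the_equality)
  show "\<exists>u' v'. hermitian u' \<and> hermitian v' \<and> u + \<i> *\<^sub>C v = u' + \<i> *\<^sub>C v' \<and> u - \<i> *\<^sub>C v = u' - \<i> *\<^sub>C v'"
    using assms by blast
next
  fix b assume "\<exists>u' v'. hermitian u' \<and> hermitian v' \<and> u + \<i> *\<^sub>C v = u' + \<i> *\<^sub>C v' \<and> b = u' - \<i> *\<^sub>C v'"
  then show "b = u - \<i> *\<^sub>C v"
    using hermitian_decomposition_unique[OF assms] by metis
qed

lemma V_setE:
  assumes "a \<in> V_set"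
  obtains u v where "hermitian u" "hermitian v" "a = u + \<i> *\<^sub>C v" "a\<^sup>\<star> = u - \<i> *\<^sub>C v"
  using assms star_eq unfolding V_set_def by fastforce

lemma normal_iff_star_commute:
  assumes "a \<in> V_set"
  shows "normal a \<longleftrightarrow> a * a\<^sup>\<star> = a\<^sup>\<star> * a"
proof -
  from assms obtain u v where uv: "hermitian u" "hermitian v"
    and a: "a = u + \<i> *\<^sub>C v" and s: "a\<^sup>\<star> = u - \<i> *\<^sub>C v"
    by (rule V_setE)
  have "a * a\<^sup>\<star> - a\<^sup>\<star> * a = 2 *\<^sub>R (\<i> *\<^sub>C (v * u - u * v))"
    unfolding s unfolding a
    by (simp add: algebra_simps mult_scaleC_left mult_scaleC_right scaleC_diff_right
        scaleC_add_right scaleR_2)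
  then have "a * a\<^sup>\<star> = a\<^sup>\<star> * a \<longleftrightarrow> norm (2 *\<^sub>R (\<i> *\<^sub>C (v * u - u * v))) = 0"
    by (metis eq_iff_diff_eq_0 norm_eq_zero)
  also have "\<dots> \<longleftrightarrow> u * v = v * u"
    by (simp only: norm_scaleR norm_scaleC) auto
  also have "\<dots> \<longleftrightarrow> normal a"
    unfolding normal_def using uv a hermitian_decomposition_unique[OF uv] by metis
  finally show ?thesis by simp
qed

text \<open>Here \<open>exp (\<i>t w) = 1 + \<i>t w\<close>, which can only stay bounded if \<open>w = 0\<close>.\<close>

lemma hermitian_square_zero:
  assumes h: "hermitian w" and sq: "w * w = 0"
  shows "w = 0"
proof (rule ccontr)
  assume "w \<noteq> 0"
  have bound: "\<bar>t\<bar> * norm w \<le> 2" for t :: real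
  proof -
    let ?x = "(\<i> * complex_of_real t) *\<^sub>C w"
    have "?x ^ 2 = 0" by (simp add: power2_eq_square mult_scaleC_left mult_scaleC_right sq)
    then have "?x ^ (n + 2) = 0" for n
      by (simp only: power_add mult_zero_right)
    then have "exp ?x = 1 + ?x"
      by (simp only: exp_first_two_terms[of ?x] scaleR_zero_right suminf_zero add_0_right)
    then have "norm (1 + ?x) = 1" using hermitianD[OF h, of t] by simp
    then have "norm ?x \<le> 2"
      using norm_triangle_ineq4[of "1 + ?x" 1] by simp
    then show ?thesis by (simp add: norm_scaleC norm_mult)
  qed
  from bound[of "3 / norm w"] \<open>w \<noteq> 0\<close> show False by simp
qed

section \<open>Hermitian idempotents\<close>

text \<open>By intertwining, \<open>z p\<close> acts as the scalar \<open>z\<close> on \<open>p\<close> and as \<open>0\<close> on \<open>1 - p\<close>.\<close>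

lemma exp_scaleC_idempotent:
  fixes p :: "'a::complex_banach_algebra_1"
  assumes "p * p = p"
  shows "exp (z *\<^sub>C p) = exp z *\<^sub>C p + (1 - p)"
proof -
  have "exp (z *\<^sub>C p) * p = p * exp (z *\<^sub>C 1)"
    by (rule exp_intertwine) (simp add: mult_scaleC_left mult_scaleC_right assms)
  then have "exp (z *\<^sub>C p) * p = exp z *\<^sub>C p"
    by (simp add: exp_scaleC_one mult_scaleC_right)
  moreover have "exp (z *\<^sub>C p) * (1 - p) = 1 - p"
    by (rule exp_mult_eq_self) (simp add: mult_scaleC_left right_diff_distrib assms)
  ultimately show ?thesis
    by (metis add_diff_cancel_left' diff_add_cancel distrib_left mult.right_neutral add.commute)
qed

lemma reflection_square:
  fixes p :: "'a::complex_banach_algebra_1"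
  assumes "p * p = p"
  shows "(1 - 2 * p) * (1 - 2 * p) = 1"
  using assms by (simp add: algebra_simps mult_2 mult_2_right)

text \<open>The reflection is \<open>exp (\<i> \<pi> p)\<close>.\<close>

lemma norm_reflection_le_one:
  assumes "hermitian p" "p * p = p"
  shows "norm (1 - 2 * p) \<le> 1"
proof -
  have "exp ((\<i> * complex_of_real pi) *\<^sub>C p) = 1 - 2 * p"
    using exp_scaleC_idempotent[OF assms(2), of "\<i> * complex_of_real pi"]
    by (simp add: scaleC_minus_left mult_2)
  then show ?thesis using hermitianD[OF assms(1), of pi] by simp
qed

lemma hermitian_conjugate_reflection:
  assumes h: "hermitian h" and p: "hermitian p" "p * p = p"
  shows "hermitian ((1 - 2 * p) * h * (1 - 2 * p))"
proof (rule hermitianI)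
  fix t :: real
  let ?U = "1 - 2 * p" and ?c = "\<i> * complex_of_real t"
  have UU: "?U * ?U = 1" by (rule reflection_square[OF p(2)])
  have "(?c *\<^sub>C (?U * h * ?U)) * ?U = ?U * (?c *\<^sub>C h)"
    by (simp add: mult_scaleC_left mult_scaleC_right mult.assoc UU)
  then have "exp (?c *\<^sub>C (?U * h * ?U)) * ?U = ?U * exp (?c *\<^sub>C h)"
    by (rule exp_intertwine)
  then have "exp (?c *\<^sub>C (?U * h * ?U)) = ?U * exp (?c *\<^sub>C h) * ?U"
    by (metis UU mult.assoc mult.right_neutral)
  also have "norm \<dots> \<le> norm (?U * exp (?c *\<^sub>C h)) * norm ?U"
    by (rule norm_mult_ineq)
  also have "\<dots> \<le> 1 * 1"
    using norm_mult_exp_hermitian[OF h, of ?U t] norm_reflection_le_one[OF p]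
    by (intro mult_mono) auto
  finally show "norm (exp (?c *\<^sub>C (?U * h * ?U))) \<le> 1" by simp
qed

text \<open>With \<open>U = 1 - 2 p\<close>, the hermitian element \<open>(h - U h U) / 2\<close> is the off-diagonal part of \<open>h\<close>. If one of the
  two equations holds, only one of its two corners is left, so it has square zero and vanishes.\<close>

lemma hermitian_idempotent_left_iff_right:
  assumes h: "hermitian h" and p: "hermitian p" "p * p = p"
  shows "p * h = h \<longleftrightarrow> h * p = h"
proof -
  let ?U = "1 - 2 * p"
  let ?w = "(1/2) *\<^sub>R (h - ?U * h * ?U)"
  have w: "hermitian ?w"
    by (intro hermitian_scaleR hermitian_diff h hermitian_conjugate_reflection p)
  \<comment> \<open>In both cases below, \<open>U h U\<close> takes the form \<open>2 y - h\<close>.\<close>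
  have half: "(1/2) *\<^sub>R (h - (2 *\<^sub>R y - h)) = h - y" for y
  proof -
    have "h - (2 *\<^sub>R y - h) = 2 *\<^sub>R (h - y)" by (simp add: scaleR_2)
    then show ?thesis by simp
  qed
  have "h * p = h" if ph: "p * h = h"
  proof -
    have phy: "p * (h * y) = h * y" for y by (simp add: mult.assoc[symmetric] ph)
    have Uh: "?U * h = - h" by (simp add: left_diff_distrib mult_2 distrib_right ph)
    have "?w = h - h * p"
      unfolding Uh by (simp add: right_diff_distrib mult_2 distrib_left scaleR_2[symmetric] half)
    moreover have "(h - h * p) * (h - h * p) = 0"
      by (simp add: algebra_simps ph phy)
    ultimately show ?thesis using hermitian_square_zero[OF w] by simp
  qed
  moreover have "p * h = h" if hp: "h * p = h"
  proof -
    have hpy: "h * (p * y) = h * y" for y by (simp add: mult.assoc[symmetric] hp)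
    have hU: "h * ?U = - h" by (simp add: right_diff_distrib mult_2 distrib_left hp)
    have "?w = h - p * h"
      unfolding mult.assoc hU by (simp add: left_diff_distrib mult_2 distrib_right scaleR_2[symmetric] half)
    moreover have "(h - p * h) * (h - p * h) = 0"
      by (simp add: algebra_simps hp hpy)
    ultimately show ?thesis using hermitian_square_zero[OF w] by simp
  qed
  ultimately show ?thesis by blast
qed

text \<open>The same one-sided exchange for \<open>a\<close> in \<open>V_set\<close>, read off from its hermitian parts. It is needed for \<open>a\<close>
  and \<open>a\<^sup>\<star>\<close> jointly, as only together do they determine the parts.\<close>

lemma V_set_idempotent_left_right:
  assumes a: "a \<in> V_set" and p: "hermitian p" "p * p = p"
  shows "p * a = a \<and> p * a\<^sup>\<star> = a\<^sup>\<star> \<longleftrightarrow> a * p = a \<and> a\<^sup>\<star> * p = a\<^sup>\<star>"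
proof -
  from a obtain u v where uv: "hermitian u" "hermitian v"
    and a: "a = u + \<i> *\<^sub>C v" and s: "a\<^sup>\<star> = u - \<i> *\<^sub>C v"
    by (rule V_setE)
  have parts: "u = (1/2) *\<^sub>R (a + a\<^sup>\<star>)" "v = (- \<i> / 2) *\<^sub>C (a - a\<^sup>\<star>)"
    unfolding s unfolding a
    by (simp_all add: scaleR_2[symmetric] scaleC_of_real[symmetric] scaleC_scaleC)
  have "p * a = a \<and> p * a\<^sup>\<star> = a\<^sup>\<star> \<longleftrightarrow> p * u = u \<and> p * v = v"
  proof
    assume "p * a = a \<and> p * a\<^sup>\<star> = a\<^sup>\<star>"
    then show "p * u = u \<and> p * v = v"
      unfolding parts by (simp add: mult_scaleC_right distrib_left right_diff_distrib)
  qed (simp add: s, simp add: a distrib_left right_diff_distrib mult_scaleC_right)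
  moreover have "a * p = a \<and> a\<^sup>\<star> * p = a\<^sup>\<star> \<longleftrightarrow> u * p = u \<and> v * p = v"
  proof
    assume "a * p = a \<and> a\<^sup>\<star> * p = a\<^sup>\<star>"
    then show "u * p = u \<and> v * p = v"
      unfolding parts by (simp add: mult_scaleC_left distrib_right left_diff_distrib)
  qed (simp add: s, simp add: a distrib_right left_diff_distrib mult_scaleC_left)
  ultimately show ?thesis
    using hermitian_idempotent_left_iff_right[OF _ p] uv by blast
qed

text \<open>Conjugation by \<open>U = 1 - 2 p\<close> fixes \<open>a = u + \<i> v\<close>, so by uniqueness it fixes \<open>u\<close> and \<open>v\<close>, which therefore
  commute with \<open>p\<close>. Then \<open>(u + \<i> v) (1 - p) = 0\<close> forces \<open>u (1 - p) = 0\<close> by \<open>hermitian_annihilator\<close>.\<close>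

lemma star_in_corner:
  assumes a: "a \<in> V_set" and p: "hermitian p" "p * p = p"
    and pa: "p * a = a" and ap: "a * p = a"
  shows "p * a\<^sup>\<star> = a\<^sup>\<star>" and "a\<^sup>\<star> * p = a\<^sup>\<star>"
proof -
  from a obtain u v where uv: "hermitian u" "hermitian v"
    and a: "a = u + \<i> *\<^sub>C v" and s: "a\<^sup>\<star> = u - \<i> *\<^sub>C v"
    by (rule V_setE)
  let ?U = "1 - 2 * p"
  have UU: "?U * ?U = 1" by (rule reflection_square[OF p(2)])
  have U_mult: "?U * a = - a" "a * ?U = - a"
    using pa ap by (simp_all add: left_diff_distrib right_diff_distrib mult_2 distrib_left distrib_right)
  then have "?U * a * ?U = a" by simp
  then have dec: "u + \<i> *\<^sub>C v = ?U * u * ?U + \<i> *\<^sub>C (?U * v * ?U)"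
    unfolding a by (simp only: distrib_left distrib_right mult_scaleC_left mult_scaleC_right)
  have comm: "p * h = h * p" if "h = ?U * h * ?U" for h
  proof -
    have "?U * h = h * ?U" using that UU by (metis mult.assoc mult.left_neutral)
    have "2 *\<^sub>R (p * h) = h - ?U * h"
      by (simp add: left_diff_distrib mult_2 distrib_right scaleR_2)
    also have "\<dots> = h - h * ?U" by (simp only: \<open>?U * h = h * ?U\<close>)
    also have "\<dots> = 2 *\<^sub>R (h * p)"
      by (simp add: right_diff_distrib mult_2 distrib_left scaleR_2)
    finally have "2 *\<^sub>R (p * h) = 2 *\<^sub>R (h * p)" .
    then show ?thesis by simp
  qed
  note herm = hermitian_conjugate_reflection[OF _ p]
  have pu: "p * u = u * p" and pv: "p * v = v * p"
    using hermitian_decomposition_unique[OF uv herm[OF uv(1)] herm[OF uv(2)] dec] by (blast intro: comm)+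
  have "(u + \<i> *\<^sub>C v) * (1 - p) = 0" using ap a by (simp add: right_diff_distrib)
  then have u: "u * (1 - p) = 0"
    by (rule hermitian_annihilator[OF uv]) (simp add: pv left_diff_distrib right_diff_distrib)
  then have "u * p = u" by (simp add: right_diff_distrib)
  moreover have "\<i> *\<^sub>C v * p = \<i> *\<^sub>C v"
    using ap \<open>u * p = u\<close> a by (simp add: distrib_right)
  ultimately show "a\<^sup>\<star> * p = a\<^sup>\<star>" by (simp add: s left_diff_distrib)
  then show "p * a\<^sup>\<star> = a\<^sup>\<star>"
    by (simp add: s left_diff_distrib right_diff_distrib mult_scaleC_left mult_scaleC_right pu pv)
qed

lemma hermitian_idempotents_eq:
  assumes "hermitian p" "hermitian q" and "(p - q) * (p - q) = 0"
  shows "p = q"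
  using hermitian_square_zero[OF hermitian_diff[OF assms(1,2)] assms(3)] by simp

lemma hermitian_idempotents_same_range:
  assumes "hermitian p" "hermitian q" "p * p = p" "q * q = q" "p * q = q" "q * p = p"
  shows "p = q"
  by (rule hermitian_idempotents_eq) (simp_all add: assms left_diff_distrib right_diff_distrib)

lemma hermitian_idempotents_same_kernel:
  assumes "hermitian p" "hermitian q" "p * p = p" "q * q = q" "p * q = p" "q * p = q"
  shows "p = q"
  by (rule hermitian_idempotents_eq) (simp_all add: assms left_diff_distrib right_diff_distrib)

section \<open>Annihilators of normal elements\<close>

text \<open>The exponent is \<open>\<i>\<close> times the hermitian element \<open>2 (Im z) u - 2 (Re z) v\<close>.\<close>

lemma norm_exp_star_minus_cnj:
  assumes uv: "hermitian u" "hermitian v"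
  shows "norm (exp (z *\<^sub>C (u - \<i> *\<^sub>C v) - cnj z *\<^sub>C (u + \<i> *\<^sub>C v))) = 1"
proof -
  let ?w = "(2 * Im z) *\<^sub>R u - (2 * Re z) *\<^sub>R v"
  have z: "z - cnj z = \<i> * of_real (2 * Im z)" "z + cnj z = of_real (2 * Re z)"
    by (simp_all add: complex_eq_iff)
  have "z *\<^sub>C (u - \<i> *\<^sub>C v) - cnj z *\<^sub>C (u + \<i> *\<^sub>C v) = (z - cnj z) *\<^sub>C u - (\<i> * (z + cnj z)) *\<^sub>C v"
    using scaleC_add_left[of z "- cnj z" u] scaleC_add_left[of "\<i> * z" "\<i> * cnj z" v]
    by (simp add: scaleC_diff_right scaleC_add_right scaleC_scaleC scaleC_minus_left distrib_left mult.commute)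
  also have "\<dots> = (\<i> * complex_of_real 1) *\<^sub>C ?w"
    unfolding z by (simp only: scaleC_diff_right scaleC_of_real[symmetric] scaleC_scaleC of_real_1 mult_1_right)
  finally show ?thesis
    using hermitianD[of ?w 1] uv by (simp add: hermitian_diff hermitian_scaleR)
qed

text \<open>The Fuglede-Rosenblum argument. If \<open>a y = 0\<close> then \<open>exp (cnj z a) y = y\<close>, and as \<open>a\<close> commutes with \<open>a\<^sup>\<star>\<close>,
  \<open>exp (z a\<^sup>\<star>) y = exp (z a\<^sup>\<star> - cnj z a) y\<close> has norm at most that of \<open>y\<close> for all \<open>z\<close>. Liouville applies.\<close>

lemma normal_annihilator:
  assumes n: "normal a"
  shows "a * y = 0 \<Longrightarrow> a\<^sup>\<star> * y = 0" and "y * a = 0 \<Longrightarrow> y * a\<^sup>\<star> = 0"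
proof -
  from n obtain u v where uv: "hermitian u" "hermitian v" and a: "a = u + \<i> *\<^sub>C v" and comm: "u * v = v * u"
    unfolding normal_def by blast
  have s: "a\<^sup>\<star> = u - \<i> *\<^sub>C v" unfolding a by (rule star_eq[OF uv])
  have "a \<in> V_set" using uv unfolding V_set_def a by blast
  then have sa: "a\<^sup>\<star> * a = a * a\<^sup>\<star>"
    using n normal_iff_star_commute by metis
  let ?D = "\<lambda>z. z *\<^sub>C a\<^sup>\<star> - cnj z *\<^sub>C a"
  have D: "norm (exp (?D z)) = 1" for z
    using norm_exp_star_minus_cnj[OF uv, of z] by (simp add: s a[symmetric])
  have split: "exp (z *\<^sub>C a\<^sup>\<star>) = exp (?D z) * exp (cnj z *\<^sub>C a)"
    "exp (z *\<^sub>C a\<^sup>\<star>) = exp (cnj z *\<^sub>C a) * exp (?D z)" for z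
    using exp_add_commuting[of "?D z" "cnj z *\<^sub>C a"] exp_add_commuting[of "cnj z *\<^sub>C a" "?D z"]
    by (simp_all add: left_diff_distrib right_diff_distrib mult_scaleC_left mult_scaleC_right
        scaleC_diff_right scaleC_scaleC mult.commute sa)
  show "a\<^sup>\<star> * y = 0" if "a * y = 0"
  proof -
    have "exp (cnj z *\<^sub>C a) * y = y" for z
      by (rule exp_mult_eq_self) (simp add: mult_scaleC_left that)
    then have "norm (1 * exp (z *\<^sub>C a\<^sup>\<star>) * y) \<le> norm y" for z
      using norm_mult_ineq[of "exp (?D z)" y] by (simp add: split(1) D mult.assoc)
    from bounded_exp_orbit_imp_zero[OF this] show ?thesis by simp
  qed
  show "y * a\<^sup>\<star> = 0" if "y * a = 0"
  proof -
    have "y * exp (cnj z *\<^sub>C a) = y" for z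
      by (rule mult_exp_eq_self) (simp add: mult_scaleC_right that)
    then have "norm (y * exp (z *\<^sub>C a\<^sup>\<star>) * 1) \<le> norm y" for z
      using norm_mult_ineq[of y "exp (?D z)"] by (simp add: split(2) D mult.assoc[symmetric])
    from bounded_exp_orbit_imp_zero[OF this] show ?thesis by simp
  qed
qed

section \<open>Moore-Penrose inverses commuting with the element\<close>

lemma mp_inverse_eq:
  assumes x: "is_mp_inverse a x"
  shows "a\<^sup>\<dagger> = x"
  unfolding mp_inverse_def
proof (rule the_equality[where P = "is_mp_inverse a", OF x])
  fix y assume y: "is_mp_inverse a y"
  note * = x[unfolded is_mp_inverse_def] y[unfolded is_mp_inverse_def]
  have xa: "a * x * a = a" "x * a * x = x" "a * y * a = a" "y * a * y = y" using * by simp_all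
  have herm: "hermitian (a * x)" "hermitian (x * a)" "hermitian (a * y)" "hermitian (y * a)" using * by simp_all
  have "a * x = a * y"
    by (rule hermitian_idempotents_same_range) (simp_all add: herm mult.assoc[symmetric] xa)
  moreover have "x * a = y * a"
    by (rule hermitian_idempotents_same_kernel)
      (simp_all add: herm mult.assoc[symmetric] xa, simp_all add: mult.assoc xa(1,3)[unfolded mult.assoc])
  ultimately show "y = x" using xa by (metis mult.assoc)
qed

lemma group_inverse_eq:
  assumes b: "is_group_inverse a b"
  shows "a\<^sup>\<sharp> = b"
  unfolding group_inverse_def
proof (rule the_equality[where P = "is_group_inverse a", OF b])
  fix c assume c: "is_group_inverse a c"
  note * = b[unfolded is_group_inverse_def] c[unfolded is_group_inverse_def]
  have comm: "a * b = b * a" "a * c = c * a" and aba: "a * b * a = a" and aca: "a * c * a = a"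
    using * by metis+
  have "a * b = (a * c * a) * b" by (simp only: aca)
  also have "\<dots> = (a * c) * (a * b)" by (simp add: mult.assoc)
  also have "\<dots> = (c * a) * (b * a)" by (simp only: comm)
  also have "\<dots> = c * (a * b * a)" by (simp add: mult.assoc)
  also have "\<dots> = a * c" by (simp only: aba) (simp only: comm)
  finally have "a * b = a * c" .
  then show "c = b" using * by (metis mult.assoc)
qed

text \<open>For the group inverse \<open>b\<close>, the hypothesis on \<open>a\<close> turns \<open>x a = x a b a\<close> into \<open>x a = a b\<close>. So \<open>a b\<close> is a
  hermitian idempotent; it has the same range as \<open>a x\<close>.\<close>

lemma mp_inverse_commutes_if_left:
  assumes x: "is_mp_inverse a x" and b: "is_group_inverse a b" and a: "a = x * a * a"
  shows "a * x = x * a"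
proof -
  have xa: "a * x * a = a" "x * a * x = x" "hermitian (a * x)" "hermitian (x * a)"
    using x unfolding is_mp_inverse_def by simp_all
  have ba: "a * b * a = a" "b * a * b = b" "a * b = b * a"
    using b unfolding is_group_inverse_def by metis+
  have "x * a = x * (a * b * a)" by (simp only: ba(1))
  also have "\<dots> = x * a * a * b" by (simp only: mult.assoc ba(3)[symmetric])
  also have "\<dots> = a * b" by (simp add: a[symmetric])
  finally have q: "x * a = a * b" .
  have "a * x = a * b"
    by (rule hermitian_idempotents_same_range)
      (use xa in \<open>simp_all add: q[symmetric], simp_all add: q mult.assoc[symmetric] ba(1)\<close>)
  with q show ?thesis by simp
qed

text \<open>The mirror image: now \<open>a x = b a\<close>, which has the same kernel as \<open>x a\<close>.\<close>

lemma mp_inverse_commutes_if_right: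
  assumes x: "is_mp_inverse a x" and b: "is_group_inverse a b" and a: "a = a * a * x"
  shows "a * x = x * a"
proof -
  have xa: "a * x * a = a" "x * a * x = x" "hermitian (a * x)" "hermitian (x * a)"
    using x unfolding is_mp_inverse_def by simp_all
  have ba: "a * b * a = a" "b * a * b = b" "a * b = b * a"
    using b unfolding is_group_inverse_def by metis+
  have "a * x = (b * a) * a * x" by (simp add: ba(3)[symmetric] ba(1))
  also have "\<dots> = b * (a * a * x)" by (simp add: mult.assoc)
  also have "\<dots> = b * a" by (simp add: a[symmetric])
  finally have p: "a * x = b * a" .
  have "x * a = b * a"
  proof (rule hermitian_idempotents_same_kernel)
    show "hermitian (b * a)" using xa(3) by (simp add: p)
    show "(x * a) * (b * a) = x * a" by (metis ba(1) mult.assoc)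
  qed (use xa in \<open>simp_all add: mult.assoc[symmetric] ba(2), simp_all add: mult.assoc\<close>)
  with p show ?thesis by simp
qed

text \<open>As \<open>a x\<close> is a left unit for \<open>a\<close> anyway, it is one for both hermitian parts of \<open>a\<close> once it is one for
  \<open>a\<^sup>\<star>\<close>, and such a unit is two-sided. This lemma and its mirror image supply the hypotheses of
  \<open>mp_inverse_commutes_if_right\<close> and \<open>mp_inverse_commutes_if_left\<close>.\<close>

lemma star_left_unit_imp_right_unit:
  assumes a: "a \<in> V_set" and x: "is_mp_inverse a x" and star: "a * x * a\<^sup>\<star> = a\<^sup>\<star>"
  shows "a = a * a * x"
proof -
  have xa: "a * x * a = a" "hermitian (a * x)" "(a * x) * (a * x) = a * x"
    using x unfolding is_mp_inverse_def by (simp_all add: mult.assoc[symmetric])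
  then have "a * (a * x) = a"
    using V_set_idempotent_left_right[OF a xa(2,3)] star by simp
  then show ?thesis by (simp add: mult.assoc)
qed

lemma star_right_unit_imp_left_unit:
  assumes a: "a \<in> V_set" and x: "is_mp_inverse a x" and star: "a\<^sup>\<star> * (x * a) = a\<^sup>\<star>"
  shows "a = x * a * a"
proof -
  have xa: "a * (x * a) = a" "hermitian (x * a)" "(x * a) * (x * a) = x * a"
    using x unfolding is_mp_inverse_def by (simp_all add: mult.assoc[symmetric])
  then show ?thesis
    using V_set_idempotent_left_right[OF a xa(2,3)] star by simp
qed

lemma normal_mp_inverse_commutes:
  assumes n: "normal a" and x: "is_mp_inverse a x"
  shows "a * x = x * a"
proof -
  have V: "a \<in> V_set" using n unfolding normal_def V_set_def by blast
  have xa: "a * x * a = a" "x * a * x = x" using x unfolding is_mp_inverse_def by simp_all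
  have "(1 - a * x) * a\<^sup>\<star> = 0"
    by (rule normal_annihilator(2)[OF n]) (simp add: left_diff_distrib xa)
  then have "a = a * a * x"
    by (intro star_left_unit_imp_right_unit[OF V x]) (simp add: left_diff_distrib)
  moreover have "a\<^sup>\<star> * (1 - x * a) = 0"
    by (rule normal_annihilator(1)[OF n]) (simp add: right_diff_distrib mult.assoc[symmetric] xa)
  then have "a = x * a * a"
    by (intro star_right_unit_imp_left_unit[OF V x]) (simp add: right_diff_distrib)
  ultimately show ?thesis by (metis mult.assoc)
qed

text \<open>Think of \<open>s = a\<^sup>\<star>\<close>: in the corner with unit \<open>a x\<close> the elements \<open>a\<close> and \<open>x\<close> are inverse to each other, so
  commuting with \<open>a\<close> can be written as invariance under conjugation by \<open>a\<close>, or as commuting with \<open>x\<close>.\<close>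

lemma corner_commute_iff:
  fixes a x s :: "'a::semigroup_mult"
  assumes ax: "a * x = x * a" and s: "a * x * s = s" "s * (a * x) = s"
  shows "s * a = a * s \<longleftrightarrow> s = a * s * x"
    and "s * a = a * s \<longleftrightarrow> s = x * s * a"
    and "s * a = a * s \<longleftrightarrow> s * x = x * s"
proof -
  show 1: "s * a = a * s \<longleftrightarrow> s = a * s * x" using ax s by (metis mult.assoc)
  show 2: "s * a = a * s \<longleftrightarrow> s = x * s * a" using ax s by (metis mult.assoc)
  show "s * a = a * s \<longleftrightarrow> s * x = x * s" using ax s 1 2 by (metis mult.assoc)
qed

text \<open>The common outer factor \<open>a\<close> or \<open>x\<close> can be cancelled because it is invertible in the corner.\<close>

lemma corner_commute_cancel:
  fixes a x s :: "'a::semigroup_mult"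
  assumes ax: "a * x = x * a" and xx: "x * a * x = x" and aa: "a * x * a = a"
    and s: "a * x * s = s" "s * (a * x) = s"
  shows "x * s * x = x * x * s \<longleftrightarrow> s * x = x * s"
    and "s * x * x = x * s * x \<longleftrightarrow> s * x = x * s"
    and "a * s * a = s * a * a \<longleftrightarrow> s * a = a * s"
    and "a * a * s = a * s * a \<longleftrightarrow> s * a = a * s"
proof -
  have ps: "a * (x * s) = s" "x * (a * s) = s"
    and sp: "s * a * x = s" "s * x * a = s"
    using s ax by (metis mult.assoc)+
  have L: "x * y = x * z \<longleftrightarrow> y = z" "a * y = a * z \<longleftrightarrow> y = z" if "a * (x * y) = y" "a * (x * z) = z" for y z
    using that ax by (metis mult.assoc)+
  have R: "y * x = z * x \<longleftrightarrow> y = z" "y * a = z * a \<longleftrightarrow> y = z" if "y * a * x = y" "z * a * x = z" for y z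
    using that ax by (metis mult.assoc)+
  have abs: "a * (x * x) = x" "a * (x * a) = a" "x * a * x = x" "a * a * x = a"
    using ax xx aa by (metis mult.assoc)+
  have corner: "a * (x * (s * x)) = s * x" "a * (x * (x * s)) = x * s"
    "a * (x * (s * a)) = s * a" "a * (x * (a * s)) = a * s"
    "s * x * a * x = s * x" "x * s * a * x = x * s" "s * a * a * x = s * a" "a * s * a * x = a * s"
    by (metis abs ps sp mult.assoc)+
  show "x * s * x = x * x * s \<longleftrightarrow> s * x = x * s"
    using L(1)[OF corner(1,2)] by (simp add: mult.assoc)
  show "s * x * x = x * s * x \<longleftrightarrow> s * x = x * s"
    using R(1)[OF corner(5,6)] by simp
  show "a * s * a = s * a * a \<longleftrightarrow> s * a = a * s"
    using R(2)[OF corner(8,7)] by auto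
  show "a * a * s = a * s * a \<longleftrightarrow> s * a = a * s"
    using L(2)[OF corner(4,3)] by (auto simp: mult.assoc)
qed

section \<open>Characterizations of normality\<close>

theorem theorem3p4:
  fixes a :: "'a::complex_banach_algebra_1"
  assumes "a \<in> V_set" and "mp_invertible a"
  shows "(normal a \<longleftrightarrow> group_invertible a \<and> a * a\<^sup>\<star> * a\<^sup>\<sharp> = a\<^sup>\<star> * a\<^sup>\<sharp> * a \<and> a = a\<^sup>\<dagger> * a * a) \<and>
         (normal a \<longleftrightarrow> group_invertible a \<and> a * a\<^sup>\<star> * a\<^sup>\<sharp> = a\<^sup>\<sharp> * a * a\<^sup>\<star> \<and> a = a * a * a\<^sup>\<dagger>) \<and>
         (normal a \<longleftrightarrow> group_invertible a \<and> a * a\<^sup>\<sharp> * a\<^sup>\<star> = a\<^sup>\<sharp> * a\<^sup>\<star> * a \<and> a = a * a * a\<^sup>\<dagger>) \<and>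
         (normal a \<longleftrightarrow> group_invertible a \<and> a\<^sup>\<star> * a * a\<^sup>\<sharp> = a\<^sup>\<sharp> * a\<^sup>\<star> * a \<and> a = a\<^sup>\<dagger> * a * a) \<and>
         (normal a \<longleftrightarrow> group_invertible a \<and> a\<^sup>\<dagger> * a\<^sup>\<star> * a\<^sup>\<sharp> = a\<^sup>\<dagger> * a\<^sup>\<sharp> * a\<^sup>\<star> \<and> a = a * a * a\<^sup>\<dagger>) \<and>
         (normal a \<longleftrightarrow> group_invertible a \<and> a\<^sup>\<star> * a\<^sup>\<sharp> * a\<^sup>\<dagger> = a\<^sup>\<sharp> * a\<^sup>\<star> * a\<^sup>\<dagger> \<and> a = a\<^sup>\<dagger> * a * a) \<and>
         (normal a \<longleftrightarrow> group_invertible a \<and> a\<^sup>\<star> = a * a\<^sup>\<star> * a\<^sup>\<sharp>) \<and>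
         (normal a \<longleftrightarrow> group_invertible a \<and> a\<^sup>\<star> = a\<^sup>\<sharp> * a\<^sup>\<star> * a) \<and>
         (normal a \<longleftrightarrow> group_invertible a \<and> a * a\<^sup>\<star> * a = a\<^sup>\<star> * a * a \<and> a = a\<^sup>\<dagger> * a * a) \<and>
         (normal a \<longleftrightarrow> group_invertible a \<and> a * a * a\<^sup>\<star> = a * a\<^sup>\<star> * a \<and> a = a * a * a\<^sup>\<dagger>)"
proof -
  from assms(2) obtain x where x: "is_mp_inverse a x" unfolding mp_invertible_def by blast
  have dag: "a\<^sup>\<dagger> = x" by (rule mp_inverse_eq[OF x])
  have xa: "a * x * a = a" "x * a * x = x" and herm: "hermitian (a * x)"
    using x unfolding is_mp_inverse_def by simp_all
  let ?s = "a\<^sup>\<star>"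
  have sharp: "is_group_inverse a (a\<^sup>\<sharp>)" if "group_invertible a"
    using that group_inverse_eq unfolding group_invertible_def by metis
  have left: "a * x = x * a" if "group_invertible a" "a = a\<^sup>\<dagger> * a * a"
    using mp_inverse_commutes_if_left[OF x sharp] that dag by simp
  have right: "a * x = x * a" if "group_invertible a" "a = a * a * a\<^sup>\<dagger>"
    using mp_inverse_commutes_if_right[OF x sharp] that dag by simp
  \<comment> \<open>Here \<open>a\<^sup>\<star>\<close> has the left factor \<open>a\<close>, for which \<open>a x\<close> is a left unit; \<open>star_conj_right\<close> is the mirror image.\<close>
  have star_conj_left: "a * x = x * a" if g: "group_invertible a" and s: "?s = a * ?s * a\<^sup>\<sharp>"
  proof (rule right[OF g])
    have "a * x * ?s = a * x * (a * ?s * a\<^sup>\<sharp>)" by (rule arg_cong[OF s])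
    also have "\<dots> = (a * x * a) * ?s * a\<^sup>\<sharp>" by (simp only: mult.assoc)
    also have "\<dots> = ?s" by (simp only: xa s[symmetric])
    finally have "a * x * ?s = ?s" .
    then show "a = a * a * a\<^sup>\<dagger>"
      unfolding dag by (rule star_left_unit_imp_right_unit[OF assms(1) x])
  qed
  have star_conj_right: "a * x = x * a" if g: "group_invertible a" and s: "?s = a\<^sup>\<sharp> * ?s * a"
  proof (rule left[OF g])
    have "?s * (x * a) = a\<^sup>\<sharp> * ?s * a * (x * a)" by (rule arg_cong[OF s])
    also have "\<dots> = a\<^sup>\<sharp> * ?s * (a * x * a)" by (simp only: mult.assoc)
    also have "\<dots> = ?s" by (simp only: xa s[symmetric])
    finally have "?s * (x * a) = ?s" .
    then show "a = a\<^sup>\<dagger> * a * a"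
      unfolding dag by (rule star_right_unit_imp_left_unit[OF assms(1) x])
  qed
  show ?thesis
  proof (cases "a * x = x * a")
    \<comment> \<open>Every side of every equivalence implies that \<open>a\<close> and \<open>x\<close> commute, so otherwise all of them fail.\<close>
    case False
    then have "\<not> normal a" using normal_mp_inverse_commutes[OF _ x] by blast
    with False left right star_conj_left star_conj_right show ?thesis by blast
  next
    case True
    then have gi: "is_group_inverse a x" using xa by (simp add: is_group_inverse_def)
    then have g: "group_invertible a" and shp: "a\<^sup>\<sharp> = x"
      by (auto simp: group_invertible_def group_inverse_eq)
    have a1: "a = x * a * a" and a2: "a = a * a * x" using xa True by (metis mult.assoc)+
    have idem: "(a * x) * (a * x) = a * x" by (simp add: mult.assoc[symmetric] xa)
    have ps: "a * x * ?s = ?s" and sp: "?s * (a * x) = ?s"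
      using star_in_corner[OF assms(1) herm idem] a2 xa by (simp_all add: mult.assoc)
    have ps': "x * a * ?s = ?s" and sp': "?s * a * x = ?s" "?s * x * a = ?s"
      using ps sp True by (simp_all add: mult.assoc)
    have n: "normal a \<longleftrightarrow> ?s * a = a * ?s"
      using normal_iff_star_commute[OF assms(1)] by auto
    note iff = corner_commute_iff[OF True ps sp]
    note cancel = corner_commute_cancel[OF True xa(2,1) ps sp]
    have "normal a \<longleftrightarrow> a * ?s * x = ?s" "normal a \<longleftrightarrow> ?s = x * ?s * a"
      using n iff(1,2) by auto
    then show ?thesis
      unfolding dag shp cancel ps ps' sp' using g a1 a2 n iff by metis
  qed
qed

end
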